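(* $q(\xi)<0$ for $0<\xi<\xi_0$; $q(\xi_0)=0$; and $q(\xi)>0$ for $\xi>\xi_0$.
   Context: $D=\{(t,q)\in\mathbb{R}^2:2t-q>1\}$, $D_0=\{(t,q)\in\mathbb{R}^2:2t-q>1,\ 0\le t\le1\}$. Write $[\omega_1,\dots,\omega_n+x]=\cfrac{1}{\omega_1+\cfrac{1}{\ddots+\cfrac{1}{\omega_n+x}}}$. For $(t,q)\in D$, $$P(t,q)=\lim_{n\to\infty}\frac1n\log\sum_{\omega_1=1}^\infty\cdots\sum_{\omega_n=1}^\infty\exp\Big(\sup_{x\in[0,1]}\log\prod_{j=1}^n\omega_j^q\,([\omega_j,\dots,\omega_n+x])^{2t}\Big),$$ a real-analytic function on $D$. For $\xi>0$, $(t(\xi),q(\xi))\in D_0$ is the unique solution in $D_0$ of the system $P(t,q)=q\xi$, $\frac{\partial P}{\partial q}(t,q)=\xi$. $\xi_0=\int\log a_1(x)\,d\mu_G(x)$, where $a_1(x)=\lfloor1/x\rfloor$ and $d\mu_G=\frac{dx}{(1+x)\log2}$ is the Gauss measure on $[0,1)$. *)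

theory Defs
  imports "HOL-Analysis.Analysis"
begin

definition D0 :: "(real \<times> real) set" where
  "D0 = {(t, q). 2 * t - q > 1 \<and> 0 \<le> t \<and> t \<le> 1}"

text \<open>The word \<open>\<omega>\<close> with last digit shifted by \<open>x\<close>:
  \<open>cf [w1, \<dots>, wn] x\<close> is the finite continued fraction \<open>[w1, \<dots>, wn + x]\<close> (no integer part).\<close>

fun cf :: "nat list \<Rightarrow> real \<Rightarrow> real" where
  "cf [] x = x"
| "cf (a # \<omega>) x = 1 / (real a + cf \<omega> x)"

definition words :: "nat \<Rightarrow> nat list set" where
  "words n = {\<omega>. length \<omega> = n \<and> (\<forall>a\<in>set \<omega>. 1 \<le> a)}"

text \<open>Indices are shifted by one: \<open>\<omega> ! j\<close> is the digit number \<open>j + 1\<close>, and \<open>drop j \<omega>\<close> is the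
  word starting with that digit. The \<open>n\<close>-fold sum over positive digits is taken as one unordered
  sum over words; its terms are positive, so it equals the iterated sum whenever that converges,
  in particular if \<open>2 * t - q > 1\<close>.\<close>

definition partition_sum :: "real \<Rightarrow> real \<Rightarrow> nat \<Rightarrow> real" where
  "partition_sum t q n =
     (\<Sum>\<^sub>\<infinity>\<omega>\<in>words n. exp (SUP x\<in>{0..1}.
        ln (\<Prod>j<n. real (\<omega> ! j) powr q * cf (drop j \<omega>) x powr (2 * t))))"

text \<open>Only the values with \<open>2 * t - q > 1\<close> are meaningful.\<close>

definition P :: "real \<Rightarrow> real \<Rightarrow> real" where
  "P t q = lim (\<lambda>n. 1 / real n * ln (partition_sum t q n))"

definition solves_system :: "real \<Rightarrow> real \<Rightarrow> real \<Rightarrow> bool" where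
  "solves_system \<xi> t q \<longleftrightarrow>
     P t q = q * \<xi> \<and> ((\<lambda>q'. P t q') has_real_derivative \<xi>) (at q)"

definition unique_solution_in_D0 :: "real \<Rightarrow> real \<Rightarrow> real \<Rightarrow> bool" where
  "unique_solution_in_D0 \<xi> t q \<longleftrightarrow>
     (t, q) \<in> D0 \<and> solves_system \<xi> t q \<and>
     (\<forall>t' q'. (t', q') \<in> D0 \<and> solves_system \<xi> t' q' \<longrightarrow> t' = t \<and> q' = q)"

definition gauss_measure :: "real measure" where
  "gauss_measure =
     density (restrict_space lborel {0..<1}) (\<lambda>x. ennreal (1 / ((1 + x) * ln 2)))"

definition a1 :: "real \<Rightarrow> int" where
  "a1 x = \<lfloor>1 / x\<rfloor>"

text \<open>At the null point \<open>x = 0\<close> the integrand is \<open>ln 0 = 0\<close> by convention.\<close>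

definition \<xi>0 :: real where
  "\<xi>0 = (\<integral>x. ln (real_of_int (a1 x)) \<partial>gauss_measure)"

end

theory Submission
  imports Defs
begin

text \<open>
  On \<open>D0\<close> the pressure satisfies \<open>P t q \<ge> q * \<xi>0\<close>: it decreases in \<open>t\<close>, and for \<open>t = 1\<close> the weights of
  the partition sum are comparable to \<open>(\<omega>\<^sub>1 \<cdots> \<omega>\<^sub>n)\<^sup>q\<close> times the Gauss mass of the cylinder, so Jensen's
  inequality and the invariance of the Gauss measure apply.  A solution with \<open>P t q = q * \<xi>\<close> hence
  has \<open>q * (\<xi> - \<xi>0) \<ge> 0\<close>.  If \<open>q = 0\<close>, the function \<open>P t q - q * \<xi>0\<close> has a minimum at \<open>0\<close>, which forces
  \<open>\<xi> = \<xi>0\<close>.  For \<open>\<xi> = \<xi>0\<close> and \<open>q \<noteq> 0\<close>, convexity (Hoelder, with \<open>P 1 0 \<le> 0\<close>) makes \<open>P 1\<close> linear of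
  slope \<open>\<xi>0\<close> between \<open>0\<close> and \<open>q\<close>, which contradicts uniqueness.  Thus the differentiability of \<open>P\<close>
  is never needed beyond what the system itself asserts.
\<close>

subsection \<open>Words and continued fractions\<close>

lemma has_sum_atLeast1I:
  fixes f :: "nat \<Rightarrow> real"
  assumes "(\<lambda>k. f (Suc k)) sums s" and "\<And>k. f (Suc k) \<ge> 0"
  shows "(f has_sum s) {1..}"
proof -
  have "((\<lambda>k. f (Suc k)) has_sum s) UNIV"
    by (rule sums_nonneg_imp_has_sum) (use assms in auto)
  moreover have "bij_betw Suc UNIV {1..}"
    by (auto simp: bij_betw_def image_def) (metis Suc_le_D)
  ultimately show ?thesis
    using has_sum_reindex_bij_betw by blast
qed

lemma words_0: "words 0 = {[]}"
  by (auto simp: words_def)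

lemma has_sum_words_0: "(f has_sum f []) (words 0)"
  for f :: "nat list \<Rightarrow> real"
  using has_sum_finite[of "{[]}" f] by (simp add: words_0)

lemma words_Suc_bij: "bij_betw (\<lambda>(a, \<omega>). a # \<omega>) ({1..} \<times> words n) (words (Suc n))"
  by (auto simp: bij_betw_def inj_on_def words_def length_Suc_conv image_iff)

lemma words_Suc_bij_swap: "bij_betw (\<lambda>(\<omega>, a). a # \<omega>) (words n \<times> {1..}) (words (Suc n))"
  by (auto simp: bij_betw_def inj_on_def words_def length_Suc_conv image_iff)

lemma words_append_bij:
  "bij_betw (\<lambda>(\<omega>, \<eta>). \<omega> @ \<eta>) (words m \<times> words n) (words (m + n))"
proof -
  have "\<exists>\<eta>\<in>words m. \<exists>\<eta>'\<in>words n. \<omega> = \<eta> @ \<eta>'" if "\<omega> \<in> words (m + n)" for \<omega>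
    by (rule bexI[of _ "take m \<omega>"], rule bexI[of _ "drop m \<omega>"])
       (use that in \<open>auto simp: words_def dest: in_set_takeD in_set_dropD\<close>)
  then show ?thesis
    by (auto simp: bij_betw_def inj_on_def image_iff words_def)
qed

lemma has_sum_words_Suc:
  fixes f :: "nat list \<Rightarrow> real"
  assumes "\<And>a. a \<ge> 1 \<Longrightarrow> ((\<lambda>\<omega>. f (a # \<omega>)) has_sum g a) (words n)" "(g has_sum s) {1..}"
    and "\<And>\<omega>. \<omega> \<in> words (Suc n) \<Longrightarrow> f \<omega> \<ge> 0"
  shows "(f has_sum s) (words (Suc n))"
proof -
  let ?h = "\<lambda>(a, \<omega>). f (a # \<omega>)"
  have "(?h has_sum s) ({1..} \<times> words n)"
  proof (rule has_sum_SigmaI)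
    show "?h summable_on {1..} \<times> words n"
      by (rule summable_on_SigmaI[where g = g])
         (use assms in \<open>auto simp: words_def summable_on_def\<close>)
  qed (use assms in auto)
  then show ?thesis
    using has_sum_reindex_bij_betw[OF words_Suc_bij, of f n s]
    by (simp add: case_prod_unfold)
qed

lemma has_sum_words_Suc_swap:
  fixes f :: "nat list \<Rightarrow> real"
  assumes "\<And>\<omega>. \<omega> \<in> words n \<Longrightarrow> ((\<lambda>a. f (a # \<omega>)) has_sum g \<omega>) {1..}" "(g has_sum s) (words n)"
    and "\<And>\<omega>. \<omega> \<in> words (Suc n) \<Longrightarrow> f \<omega> \<ge> 0"
  shows "(f has_sum s) (words (Suc n))"
proof -
  let ?h = "\<lambda>(\<omega>, a). f (a # \<omega>)"
  have "(?h has_sum s) (words n \<times> {1..})"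
  proof (rule has_sum_SigmaI)
    show "?h summable_on words n \<times> {1..}"
      by (rule summable_on_SigmaI[where g = g])
         (use assms in \<open>auto simp: words_def summable_on_def\<close>)
  qed (use assms in auto)
  then show ?thesis
    using has_sum_reindex_bij_betw[OF words_Suc_bij_swap, of f n s]
    by (simp add: case_prod_unfold)
qed

primrec cfprod :: "nat list \<Rightarrow> real \<Rightarrow> real" where
  "cfprod [] x = 1"
| "cfprod (a # \<omega>) x = cf (a # \<omega>) x * cfprod \<omega> x"

lemma cf_append: "cf (\<omega> @ \<eta>) x = cf \<omega> (cf \<eta> x)"
  by (induction \<omega>) auto

lemma cfprod_append: "cfprod (\<omega> @ \<eta>) x = cfprod \<omega> (cf \<eta> x) * cfprod \<eta> x"
  by (induction \<omega>) (auto simp: cf_append)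

lemma words_SucE:
  assumes "\<omega> \<in> words (Suc n)"
  obtains a \<eta> where "\<omega> = a # \<eta>" "a \<ge> 1" "\<eta> \<in> words n"
  using assms by (cases \<omega>) (auto simp: words_def)

lemma cf_bounds:
  assumes "\<omega> \<in> words n" "x \<in> {0..1}"
  shows "cf \<omega> x \<in> {0..1}"
  using assms
proof (induction n arbitrary: \<omega>)
  case (Suc n)
  then obtain a \<eta> where "\<omega> = a # \<eta>" "a \<ge> 1" "\<eta> \<in> words n" by (elim words_SucE)
  then show ?case using Suc.IH[of \<eta>] Suc.prems by (auto simp: divide_simps)
qed (auto simp: words_0)

lemma cfprod_bounds:
  assumes "\<omega> \<in> words n" "x \<in> {0..1}"
  shows "cfprod \<omega> x > 0" "cfprod \<omega> x \<le> 1" "real (prod_list \<omega>) * cfprod \<omega> x \<le> 1"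
    and "prod_list \<omega> \<ge> 1"
proof -
  have "cfprod \<omega> x > 0 \<and> cfprod \<omega> x \<le> 1 \<and> real (prod_list \<omega>) * cfprod \<omega> x \<le> 1 \<and> prod_list \<omega> \<ge> 1"
    using assms
  proof (induction n arbitrary: \<omega>)
    case (Suc n)
    then obtain a \<eta> where \<omega>: "\<omega> = a # \<eta>" "a \<ge> 1" "\<eta> \<in> words n" by (elim words_SucE)
    have IH: "cfprod \<eta> x > 0" "cfprod \<eta> x \<le> 1" "real (prod_list \<eta>) * cfprod \<eta> x \<le> 1"
      "prod_list \<eta> \<ge> 1"
      using Suc.IH[of \<eta>] \<omega> Suc.prems by auto
    have c: "cf \<eta> x \<in> {0..1}" using cf_bounds \<omega> Suc.prems by blast
    have 1: "cf \<omega> x > 0" "cf \<omega> x \<le> 1" "real a * cf \<omega> x \<le> 1"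
      using c \<omega> by (auto simp: divide_simps)
    have "real (prod_list \<omega>) * cfprod \<omega> x = (real a * cf \<omega> x) * (real (prod_list \<eta>) * cfprod \<eta> x)"
      using \<omega> by simp
    also have "\<dots> \<le> 1 * 1" by (rule mult_mono) (use 1 IH in auto)
    finally show ?case using 1 IH \<omega>(1,2)
      by (auto intro!: mult_le_one simp del: cf.simps)
  qed (auto simp: words_0)
  then show "cfprod \<omega> x > 0" "cfprod \<omega> x \<le> 1" "real (prod_list \<omega>) * cfprod \<omega> x \<le> 1"
    "prod_list \<omega> \<ge> 1" by auto
qed

lemma cf_diff:
  assumes "\<omega> \<in> words n" "x \<in> {0..1}" "y \<in> {0..1}"
  shows "\<bar>cf \<omega> x - cf \<omega> y\<bar> = cfprod \<omega> x * cfprod \<omega> y * \<bar>x - y\<bar>"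
  using assms
proof (induction n arbitrary: \<omega>)
  case (Suc n)
  then obtain a \<eta> where \<omega>: "\<omega> = a # \<eta>" "a \<ge> 1" "\<eta> \<in> words n" by (elim words_SucE)
  have c: "cf \<eta> x \<in> {0..1}" "cf \<eta> y \<in> {0..1}" using cf_bounds \<omega> Suc.prems by blast+
  then have pos: "real a + cf \<eta> x > 0" "real a + cf \<eta> y > 0" using \<omega> by auto
  have "cf \<omega> x - cf \<omega> y = (cf \<eta> y - cf \<eta> x) * (cf \<omega> x * cf \<omega> y)"
    using pos \<omega> by (simp add: divide_simps)
  moreover have "cf \<omega> x * cf \<omega> y \<ge> 0" using pos \<omega> by simp
  ultimately have "\<bar>cf \<omega> x - cf \<omega> y\<bar> = \<bar>cf \<eta> x - cf \<eta> y\<bar> * (cf \<omega> x * cf \<omega> y)"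
    by (metis abs_minus_commute abs_mult abs_of_nonneg)
  also have "\<bar>cf \<eta> x - cf \<eta> y\<bar> = cfprod \<eta> x * cfprod \<eta> y * \<bar>x - y\<bar>"
    using Suc \<omega> by blast
  finally show ?case using \<omega>(1) by (simp add: mult_ac)
qed (auto simp: words_0)

text \<open>The denominators \<open>A\<close> and \<open>B\<close> are the continuants \<open>q\<^sub>n\<close> and \<open>q\<^bsub>n-1\<^esub>\<close> of the word.
  The inequality \<open>B + D \<le> A + C\<close> only serves to make \<open>B \<le> A\<close> inductive, starting from the empty word.\<close>

lemma cf_moebius:
  assumes "\<omega> \<in> words n"
  shows "\<exists>A B C D. 0 < A \<and> 0 \<le> B \<and> 0 \<le> C \<and> 0 \<le> D \<and> B \<le> A \<and> B + D \<le> A + C \<and>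
    (\<forall>x\<in>{0..1}. cf \<omega> x = (C + x * D) / (A + x * B) \<and> cfprod \<omega> x = 1 / (A + x * B))"
  using assms
proof (induction n arbitrary: \<omega>)
  case 0
  then show ?case
    by (intro exI[of _ 1] exI[of _ 0]) (auto simp: words_0)
next
  case (Suc n)
  then obtain a \<eta> where \<omega>: "\<omega> = a # \<eta>" "a \<ge> 1" "\<eta> \<in> words n" by (elim words_SucE)
  from Suc.IH[OF \<omega>(3)] obtain A B C D where
    *: "0 < A" "0 \<le> B" "0 \<le> C" "0 \<le> D" "B \<le> A" "B + D \<le> A + C" and
    f: "\<And>x. x\<in>{0..1} \<Longrightarrow> cf \<eta> x = (C + x * D) / (A + x * B)"
       "\<And>x. x\<in>{0..1} \<Longrightarrow> cfprod \<eta> x = 1 / (A + x * B)" by blast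
  have "(real a - 1) * B \<le> (real a - 1) * A" using * \<omega> by (intro mult_left_mono) auto
  then have B: "a * B + D \<le> a * A + C" using * by (simp add: algebra_simps)
  have pos: "a * A + C > 0" using * \<omega> by (simp add: add_pos_nonneg)
  have "cf \<omega> x = (A + x * B) / ((a * A + C) + x * (a * B + D)) \<and>
        cfprod \<omega> x = 1 / ((a * A + C) + x * (a * B + D))" if x: "x \<in> {0..1}" for x
  proof -
    have p: "A + x * B > 0" using * x by (simp add: add_pos_nonneg)
    have p2: "(a * A + C) + x * (a * B + D) > 0"
      using * x by (intro add_pos_nonneg[OF pos]) auto
    have "real a + cf \<eta> x = ((a * A + C) + x * (a * B + D)) / (A + x * B)"
      using f[OF x] p by (simp add: field_simps)
    then show ?thesis using \<omega> f[OF x] p p2 by simp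
  qed
  moreover have "0 \<le> a * B + D" "a * B + D + B \<le> a * A + C + A" using * B by auto
  ultimately show ?case using * B pos
    by (intro exI[of _ "a * A + C"] exI[of _ "a * B + D"] exI[of _ A] exI[of _ B] conjI) simp_all
qed

lemma cfprod_distortion:
  assumes "\<omega> \<in> words n" "x \<in> {0..1}" "y \<in> {0..1}"
  shows "cfprod \<omega> x \<le> 2 * cfprod \<omega> y"
proof -
  obtain A B where *: "0 < A" "0 \<le> B" "B \<le> A" 
    and f: "\<And>x. x\<in>{0..1} \<Longrightarrow> cfprod \<omega> x = 1 / (A + x * B)"
    using cf_moebius[OF assms(1)] by blast
  have "y * B \<le> 1 * A" using * assms by (intro mult_mono) auto
  moreover have "x * B \<ge> 0" "y * B \<ge> 0" using * assms by auto
  ultimately have "A + y * B > 0 \<and> A + x * B > 0 \<and> A + y * B \<le> 2 * (A + x * B)"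
    using * by (auto simp: algebra_simps)
  then have "1 / (A + x * B) \<le> 2 * (1 / (A + y * B))" by (simp add: field_simps)
  then show ?thesis using f assms by simp
qed

definition weight :: "real \<Rightarrow> real \<Rightarrow> nat list \<Rightarrow> real" where
  "weight t q \<omega> =
     exp (SUP x\<in>{0..1}. ln (real (prod_list \<omega>) powr q * cfprod \<omega> x powr (2 * t)))"

lemma prod_digits_eq:
  assumes "\<omega> \<in> words n" "x \<in> {0..1}"
  shows "(\<Prod>j<n. real (\<omega> ! j) powr q * cf (drop j \<omega>) x powr (2 * t)) =
    real (prod_list \<omega>) powr q * cfprod \<omega> x powr (2 * t)"
  using assms
proof (induction n arbitrary: \<omega>)
  case (Suc n)
  then obtain a \<eta> where \<omega>: "\<omega> = a # \<eta>" "a \<ge> 1" "\<eta> \<in> words n" by (elim words_SucE)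
  have "cf \<omega> x \<in> {0..1}" by (rule cf_bounds) (use Suc.prems in auto)
  moreover have "cfprod \<eta> x > 0" by (rule cfprod_bounds) (use \<omega> Suc.prems in auto)
  ultimately show ?case
    using Suc.IH[OF \<omega>(3)] Suc.prems(2) \<omega>
    by (simp add: prod.lessThan_Suc_shift powr_mult mult_ac del: cf.simps prod.lessThan_Suc)
qed (auto simp: words_0)

lemma partition_sum_eq: "partition_sum t q n = infsum (weight t q) (words n)"
  unfolding partition_sum_def weight_def
  by (intro infsum_cong arg_cong[where f = exp] SUP_cong refl) (simp add: prod_digits_eq)

lemma weight_term_bounds:
  assumes "\<omega> \<in> words n" "x \<in> {0..1}" "t \<ge> 0"
  shows "real (prod_list \<omega>) powr q * cfprod \<omega> x powr (2 * t) > 0"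
    and "real (prod_list \<omega>) powr q * cfprod \<omega> x powr (2 * t) \<le> real (prod_list \<omega>) powr (q - 2 * t)"
proof -
  note * = cfprod_bounds[OF assms(1,2)]
  then have N: "real (prod_list \<omega>) > 0" by linarith
  then show "real (prod_list \<omega>) powr q * cfprod \<omega> x powr (2 * t) > 0" using * by simp
  have "cfprod \<omega> x \<le> 1 / real (prod_list \<omega>)" using * N by (simp add: field_simps)
  then have "cfprod \<omega> x powr (2 * t) \<le> (1 / real (prod_list \<omega>)) powr (2 * t)"
    using * assms by (intro powr_mono2) auto
  also have "\<dots> = real (prod_list \<omega>) powr (- (2 * t))"
    using N by (simp add: powr_divide powr_minus field_simps)
  finally have "real (prod_list \<omega>) powr q * cfprod \<omega> x powr (2 * t) \<le>
      real (prod_list \<omega>) powr q * real (prod_list \<omega>) powr (- (2 * t))"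
    by (intro mult_left_mono) auto
  then show "real (prod_list \<omega>) powr q * cfprod \<omega> x powr (2 * t) \<le> real (prod_list \<omega>) powr (q - 2 * t)"
    by (simp flip: powr_add)
qed

lemma weight_ge:
  assumes "\<omega> \<in> words n" "x \<in> {0..1}" "t \<ge> 0"
  shows "real (prod_list \<omega>) powr q * cfprod \<omega> x powr (2 * t) \<le> weight t q \<omega>"
proof -
  let ?f = "\<lambda>x. real (prod_list \<omega>) powr q * cfprod \<omega> x powr (2 * t)"
  have "ln (?f x) \<le> (SUP x\<in>{0..1}. ln (?f x))"
  proof (rule cSUP_upper)
    show "bdd_above ((\<lambda>x. ln (?f x)) ` {0..1})"
    proof (rule bdd_aboveI2)
      fix y :: real assume "y \<in> {0..1}"
      then show "ln (?f y) \<le> ln (real (prod_list \<omega>) powr (q - 2 * t))"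
        using weight_term_bounds[OF assms(1) _ assms(3), of y q] by (intro ln_mono) auto
    qed
  qed fact
  then have "exp (ln (?f x)) \<le> weight t q \<omega>" by (simp add: weight_def)
  then show ?thesis using weight_term_bounds(1)[OF assms, of q] by simp
qed

lemma weight_le:
  assumes "\<omega> \<in> words n" "t \<ge> 0"
    and "\<And>x. x \<in> {0..1} \<Longrightarrow> real (prod_list \<omega>) powr q * cfprod \<omega> x powr (2 * t) \<le> c"
  shows "weight t q \<omega> \<le> c"
proof -
  let ?f = "\<lambda>x. real (prod_list \<omega>) powr q * cfprod \<omega> x powr (2 * t)"
  have c: "c > 0"
    using assms(3)[of 0] weight_term_bounds(1)[OF assms(1) _ assms(2), of 0 q] by auto
  have "(SUP x\<in>{0..1}. ln (?f x)) \<le> ln c"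
    by (rule cSUP_least) (use weight_term_bounds(1)[OF assms(1) _ assms(2)] assms(3) c in
      \<open>auto intro!: ln_mono\<close>)
  then have "weight t q \<omega> \<le> exp (ln c)" by (simp add: weight_def)
  then show ?thesis using c by simp
qed

lemma weight_pos: "weight t q \<omega> > 0"
  by (simp add: weight_def)

subsection \<open>Existence of the pressure\<close>

lemma fekete:
  fixes u :: "nat \<Rightarrow> real"
  assumes sub: "\<And>m n. u (m + n) \<le> u m + u n" and lower: "\<And>n. - K * real n \<le> u n"
  shows "convergent (\<lambda>n. u n / real n)"
proof -
  define L where "L = (INF n\<in>{1..}. u n / real n)"
  have bdd: "bdd_below ((\<lambda>n. u n / real n) ` {1..})"
    by (rule bdd_belowI2[of _ "- K"]) (use lower in \<open>auto simp: field_simps\<close>)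
  have ge: "L \<le> u n / real n" if "n \<ge> 1" for n
    unfolding L_def by (rule cINF_lower[OF bdd]) (use that in auto)
  have mult: "u (k * m + r) \<le> real k * u m + u r" for k m r
  proof (induction k)
    case (Suc k)
    have "u (Suc k * m + r) \<le> u m + u (k * m + r)"
      using sub[of m "k * m + r"] by (simp add: add_ac)
    then show ?case using Suc by (simp add: algebra_simps)
  qed auto
  have "(\<lambda>n. u n / real n) \<longlonglongrightarrow> L"
  proof (rule order_tendstoI)
    fix l assume "l < L"
    then have "l < u n / real n" if "n \<ge> 1" for n
      using ge[OF that] by linarith
    then show "\<forall>\<^sub>F n in sequentially. l < u n / real n"
      unfolding eventually_at_top_linorder by blast
  next
    fix c assume "L < c"
    then obtain m where m: "m \<ge> 1" "u m / real m < c"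
      unfolding L_def using cINF_less_iff[OF _ bdd] by auto
    define d where "d = u m / real m"
    define C where "C = Max ((\<lambda>r. \<bar>u r\<bar> + real r * \<bar>d\<bar>) ` {..<m})"
    have le: "u n / real n \<le> d + C / real n" if "n \<ge> 1" for n
    proof -
      define k r where "k = n div m" and "r = n mod m"
      have n: "n = k * m + r" by (simp add: k_def r_def)
      have "\<bar>u r\<bar> + real r * \<bar>d\<bar> \<le> C"
        unfolding C_def by (rule Max_ge) (use m in \<open>auto simp: r_def\<close>)
      moreover have "real r * - d \<le> real r * \<bar>d\<bar>"
        by (intro mult_left_mono abs_ge_minus_self) auto
      moreover have "u n \<le> real k * u m + u r"
        using mult[of k m r] n by simp
      moreover have "u r \<le> \<bar>u r\<bar>" by simp
      moreover have "real k * u m = (real n - real r) * d"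
        using n m by (simp add: d_def)
      ultimately have "u n \<le> real n * d + C"
        unfolding left_diff_distrib mult_minus_right by linarith
      then have "u n / real n \<le> (real n * d + C) / real n"
        by (intro divide_right_mono) auto
      then show ?thesis using that by (simp add: add_divide_distrib)
    qed
    have "(\<lambda>n. d + C / real n) \<longlonglongrightarrow> d"
      using tendsto_add[OF tendsto_const lim_const_over_n[of C]] by simp
    then have "\<forall>\<^sub>F n in sequentially. d + C / real n < c"
      using m by (intro order_tendstoD) (auto simp: d_def)
    with eventually_ge_at_top[of 1] show "\<forall>\<^sub>F n in sequentially. u n / real n < c"
      by eventually_elim (use le in \<open>auto intro: le_less_trans\<close>)
  qed
  then show ?thesis by (auto simp: convergent_def)
qed

lemma weight_submult:
  assumes "\<omega> \<in> words m" "\<eta> \<in> words n" "t \<ge> 0"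
  shows "weight t q (\<omega> @ \<eta>) \<le> weight t q \<omega> * weight t q \<eta>"
proof (rule weight_le)
  show "\<omega> @ \<eta> \<in> words (m + n)" using assms by (auto simp: words_def)
  fix x :: real assume x: "x \<in> {0..1}"
  have c: "cf \<eta> x \<in> {0..1}" using cf_bounds assms x by blast
  have "real (prod_list (\<omega> @ \<eta>)) powr q * cfprod (\<omega> @ \<eta>) x powr (2 * t) =
    (real (prod_list \<omega>) powr q * cfprod \<omega> (cf \<eta> x) powr (2 * t)) *
    (real (prod_list \<eta>) powr q * cfprod \<eta> x powr (2 * t))"
    using cfprod_bounds(1)[OF assms(1) c] cfprod_bounds(1)[OF assms(2) x]
    by (simp add: cfprod_append powr_mult)
  also have "\<dots> \<le> weight t q \<omega> * weight t q \<eta>"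
    using weight_term_bounds(1)[OF assms(2) x assms(3), of q] weight_pos[of t q \<omega>]
    by (intro mult_mono weight_ge[OF assms(1) c] weight_ge[OF assms(2) x] assms) auto
  finally show "real (prod_list (\<omega> @ \<eta>)) powr q * cfprod (\<omega> @ \<eta>) x powr (2 * t)
    \<le> weight t q \<omega> * weight t q \<eta>" .
qed fact

lemma summable_prod_list_powr:
  assumes "s < - 1"
  shows "(\<lambda>\<omega>. real (prod_list \<omega>) powr s) summable_on words n"
proof -
  have "summable (\<lambda>k. real (Suc k) powr s)"
    using assms summable_Suc_iff[of "\<lambda>k. real k powr s"] by (simp add: summable_real_powr_iff)
  then obtain Z where Z: "((\<lambda>a. real a powr s) has_sum Z) {1..}"
    using has_sum_atLeast1I[of "\<lambda>a. real a powr s"] by (auto simp: summable_def)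
  have "((\<lambda>\<omega>. real (prod_list \<omega>) powr s) has_sum Z ^ n) (words n)"
  proof (induction n)
    case (Suc n)
    show ?case
    proof (rule has_sum_words_Suc)
      show "((\<lambda>\<omega>. real (prod_list (a # \<omega>)) powr s) has_sum (real a powr s * Z ^ n)) (words n)" for a
        using has_sum_cmult_right[OF Suc, of "real a powr s"] by (simp add: powr_mult)
      show "((\<lambda>a. real a powr s * Z ^ n) has_sum Z ^ Suc n) {1..}"
        using has_sum_cmult_left[OF Z] by simp
    qed auto
  qed (use has_sum_words_0[of "\<lambda>\<omega>. real (prod_list \<omega>) powr s"] in simp)
  then show ?thesis by (auto simp: summable_on_def)
qed

lemma summable_weight:
  assumes "t \<ge> 0" "2 * t - q > 1"
  shows "weight t q summable_on words n"
proof (rule summable_on_comparison_test)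
  show "(\<lambda>\<omega>. real (prod_list \<omega>) powr (q - 2 * t)) summable_on words n"
    by (rule summable_prod_list_powr) (use assms in auto)
  show "weight t q \<omega> \<le> real (prod_list \<omega>) powr (q - 2 * t)" if "\<omega> \<in> words n" for \<omega>
    by (rule weight_le[OF that assms(1) weight_term_bounds(2)[OF that _ assms(1)]])
qed (auto intro: less_imp_le weight_pos)

lemma partition_sum_submult:
  assumes "t \<ge> 0" "2 * t - q > 1"
  shows "partition_sum t q (m + n) \<le> partition_sum t q m * partition_sum t q n"
proof -
  let ?W = "weight t q"
  have prod: "((\<lambda>(\<omega>, \<eta>). ?W \<omega> * ?W \<eta>) has_sum partition_sum t q m * partition_sum t q n)
      (words m \<times> words n)"
    unfolding partition_sum_eq
  proof (rule has_sum_SigmaI)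
    show 1: "((\<lambda>\<eta>. case (\<omega>, \<eta>) of (\<omega>, \<eta>) \<Rightarrow> ?W \<omega> * ?W \<eta>) has_sum ?W \<omega> * infsum ?W (words n)) (words n)" for \<omega>
      using has_sum_cmult_right[OF has_sum_infsum[OF summable_weight[OF assms]]] by simp
    show 2: "((\<lambda>\<omega>. ?W \<omega> * infsum ?W (words n)) has_sum infsum ?W (words m) * infsum ?W (words n)) (words m)"
      using has_sum_cmult_left[OF has_sum_infsum[OF summable_weight[OF assms]]] by simp
    show "(\<lambda>(\<omega>, \<eta>). ?W \<omega> * ?W \<eta>) summable_on words m \<times> words n"
      by (rule summable_on_SigmaI[OF 1 has_sum_imp_summable[OF 2]])
         (auto intro!: mult_nonneg_nonneg less_imp_le[OF weight_pos])
  qed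
  have "((\<lambda>(\<omega>, \<eta>). ?W (\<omega> @ \<eta>)) has_sum partition_sum t q (m + n)) (words m \<times> words n)"
    using has_sum_infsum[OF summable_weight[OF assms, of "m + n"]]
      has_sum_reindex_bij_betw[OF words_append_bij, of ?W m n]
    by (simp add: partition_sum_eq case_prod_unfold)
  from has_sum_mono[OF this prod] show ?thesis
    by (auto intro: weight_submult assms)
qed

lemma cfprod_replicate_1:
  assumes "x \<in> {0..1}"
  shows "cfprod (replicate n 1) x \<ge> (1/2) ^ n"
proof (induction n)
  case (Suc n)
  have "replicate n 1 \<in> words n" by (auto simp: words_def)
  from cf_bounds[OF this assms] have "cf (replicate (Suc n) 1) x \<ge> 1/2"
    by (auto simp: divide_simps)
  then have "1/2 * (1/2) ^ n \<le> cf (replicate (Suc n) 1) x * cfprod (replicate n 1) x"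
    using Suc by (intro mult_mono) (auto simp del: cf.simps replicate_Suc)
  then show ?case by simp
qed auto

lemma partition_sum_lower:
  assumes "t \<ge> 0" "2 * t - q > 1"
  shows "(1/2) powr (2 * t * real n) \<le> partition_sum t q n"
proof -
  let ?w = "replicate n (1::nat)"
  have w: "?w \<in> words n" by (auto simp: words_def)
  have "(1/2) powr (2 * t * real n) = ((1/2) ^ n) powr (2 * t)"
    by (simp add: powr_powr mult_ac flip: powr_realpow)
  also have "\<dots> \<le> cfprod ?w 0 powr (2 * t)"
    using cfprod_replicate_1[of 0 n] assms by (intro powr_mono2) auto
  also have "\<dots> \<le> weight t q ?w"
    using weight_ge[OF w, of 0 t q] assms by simp
  also have "\<dots> \<le> partition_sum t q n"
    unfolding partition_sum_eq
    using finite_sum_le_infsum[OF summable_weight[OF assms, of n], of "{?w}"] w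
    by (simp add: less_imp_le weight_pos)
  finally show ?thesis .
qed

lemma partition_sum_pos:
  assumes "t \<ge> 0" "2 * t - q > 1"
  shows "partition_sum t q n > 0"
  using partition_sum_lower[OF assms, of n] by (rule less_le_trans[rotated]) simp

lemma P_tendsto:
  assumes "t \<ge> 0" "2 * t - q > 1"
  shows "(\<lambda>n. ln (partition_sum t q n) / real n) \<longlonglongrightarrow> P t q"
proof -
  have "convergent (\<lambda>n. ln (partition_sum t q n) / real n)"
  proof (rule fekete)
    show "ln (partition_sum t q (m + n)) \<le> ln (partition_sum t q m) + ln (partition_sum t q n)" for m n
      using partition_sum_submult[OF assms, of m n] partition_sum_pos[OF assms]
      by (simp flip: ln_mult_pos)
    show "- (2 * t * ln 2) * real n \<le> ln (partition_sum t q n)" for n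
      using ln_mono[OF partition_sum_lower[OF assms, of n]] by (simp add: ln_powr ln_div mult_ac)
  qed
  then show ?thesis
    by (simp add: P_def convergent_LIMSEQ_iff)
qed

lemma P_mono:
  assumes "t \<ge> 0" "t \<le> 1" "2 * t - q > 1"
  shows "P 1 q \<le> P t q"
proof (rule LIMSEQ_le)
  show "\<exists>N. \<forall>n\<ge>N. ln (partition_sum 1 q n) / real n \<le> ln (partition_sum t q n) / real n"
  proof (intro exI allI impI divide_right_mono)
    fix n :: nat
    have "partition_sum 1 q n \<le> partition_sum t q n"
      unfolding partition_sum_eq
    proof (intro infsum_mono summable_weight weight_le)
      fix \<omega> and x :: real assume *: "\<omega> \<in> words n" "x \<in> {0..1}"
      have "cfprod \<omega> x powr (2 * 1) \<le> cfprod \<omega> x powr (2 * t)"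
        using cfprod_bounds[OF *] assms by (intro powr_mono') auto
      then have "real (prod_list \<omega>) powr q * cfprod \<omega> x powr (2 * 1)
          \<le> real (prod_list \<omega>) powr q * cfprod \<omega> x powr (2 * t)"
        by (intro mult_left_mono) auto
      also have "\<dots> \<le> weight t q \<omega>" by (rule weight_ge) (use * assms in auto)
      finally show "real (prod_list \<omega>) powr q * cfprod \<omega> x powr (2 * 1) \<le> weight t q \<omega>" .
    qed (use assms in auto)
    then show "ln (partition_sum 1 q n) \<le> ln (partition_sum t q n)"
      by (intro ln_mono partition_sum_pos) (use assms in auto)
  qed auto
qed (intro P_tendsto; use assms in auto)+

subsection \<open>Gauss masses of cylinders\<close>

lemma has_sum_telescope_mono:
  fixes F :: "real \<Rightarrow> real"
  assumes "mono_on {0..1} F" "continuous_on {0..1} F"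
  shows "((\<lambda>a::nat. \<bar>F (1 / real a) - F (1 / (real a + 1))\<bar>) has_sum \<bar>F 0 - F 1\<bar>) {1..}"
proof -
  define f where "f k = F (1 / real (Suc k))" for k
  have "(\<lambda>k. 1 / real (Suc k)) \<longlonglongrightarrow> 0"
    using LIMSEQ_inverse_real_of_nat by (simp add: inverse_eq_divide)
  then have lim: "f \<longlonglongrightarrow> F 0"
    unfolding f_def by (intro continuous_on_tendsto_compose[OF assms(2)]) auto
  have le: "f (Suc k) \<le> f k" for k
    unfolding f_def by (rule mono_onD[OF assms(1)]) (auto simp: divide_simps)
  have "F 0 \<le> F 1" by (rule mono_onD[OF assms(1)]) auto
  moreover have "(\<lambda>k. f k - f (Suc k)) sums (f 0 - F 0)" by (rule telescope_sums'[OF lim])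
  ultimately have s: "(\<lambda>k. \<bar>f k - f (Suc k)\<bar>) sums \<bar>F 0 - F 1\<bar>"
    using le by (simp add: f_def abs_of_nonneg)
  show ?thesis
    by (rule has_sum_atLeast1I) (use s in \<open>simp_all add: f_def add_ac\<close>)
qed

lemma has_sum_telescope:
  fixes F :: "real \<Rightarrow> real"
  assumes "mono_on {0..1} F \<or> antimono_on {0..1} F" "continuous_on {0..1} F"
  shows "((\<lambda>a::nat. \<bar>F (1 / real a) - F (1 / (real a + 1))\<bar>) has_sum \<bar>F 0 - F 1\<bar>) {1..}"
  using assms(1)
proof
  assume "antimono_on {0..1} F"
  then have "mono_on {0..1} (\<lambda>x. - F x)" by (auto simp: monotone_on_def)
  from has_sum_telescope_mono[OF this] assms(2) show ?thesis
    by (simp add: continuous_intros abs_minus_commute)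
qed (use has_sum_telescope_mono assms(2) in blast)

text \<open>Cylinders of order \<open>n\<close> partition the unit interval up to a null set, so
  the increments of \<open>F\<close> over them add up to its total increment.\<close>

lemma has_sum_cylinder_increments:
  fixes F :: "real \<Rightarrow> real"
  assumes "mono_on {0..1} F \<or> antimono_on {0..1} F" "continuous_on {0..1} F"
  shows "((\<lambda>\<omega>. \<bar>F (cf \<omega> 0) - F (cf \<omega> 1)\<bar>) has_sum \<bar>F 0 - F 1\<bar>) (words n)"
  using assms
proof (induction n arbitrary: F)
  case (Suc n)
  show ?case
  proof (rule has_sum_words_Suc[OF _ has_sum_telescope[OF Suc.prems]])
    fix a :: nat assume a: "a \<ge> 1"
    have sub: "1 / (real a + x) \<in> {0..1}" if "x \<in> {0..1}" for x
      using a that by (auto simp: divide_simps)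
    have anti: "1 / (real a + y) \<le> 1 / (real a + x)" if "x \<in> {0..1}" "y \<in> {0..1}" "x \<le> y" for x y
      using a that by (auto simp: divide_simps)
    have "mono_on {0..1} (\<lambda>x. F (1 / (real a + x))) \<or> antimono_on {0..1} (\<lambda>x. F (1 / (real a + x)))"
      using Suc.prems(1) sub anti unfolding monotone_on_def by blast
    moreover have "continuous_on {0..1} (\<lambda>x. F (1 / (real a + x)))"
      by (rule continuous_on_compose2[OF Suc.prems(2)])
         (use a sub in \<open>auto intro!: continuous_intros\<close>)
    ultimately show "((\<lambda>\<omega>. \<bar>F (cf (a # \<omega>) 0) - F (cf (a # \<omega>) 1)\<bar>) has_sum
        \<bar>F (1 / real a) - F (1 / (real a + 1))\<bar>) (words n)"
      using Suc.IH[of "\<lambda>x. F (1 / (real a + x))"] by simp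
  qed auto
next
  case (0 F)
  show ?case using has_sum_words_0[of "\<lambda>\<omega>. \<bar>F (cf \<omega> 0) - F (cf \<omega> 1)\<bar>"] by simp
qed

definition gauss_cdf :: "real \<Rightarrow> real" where
  "gauss_cdf x = ln (1 + x) / ln 2"

definition gauss_mass :: "nat list \<Rightarrow> real" where
  "gauss_mass \<omega> = \<bar>gauss_cdf (cf \<omega> 0) - gauss_cdf (cf \<omega> 1)\<bar>"

lemma gauss_cdf_mono: "mono_on {0..1} gauss_cdf"
  by (auto intro!: mono_onI divide_right_mono simp: gauss_cdf_def)

lemma gauss_cdf_cont: "continuous_on {0..1} gauss_cdf"
  unfolding gauss_cdf_def by (intro continuous_intros) auto

lemma gauss_mass_has_sum: "(gauss_mass has_sum 1) (words n)"
proof -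
  have "gauss_mass = (\<lambda>\<omega>. \<bar>gauss_cdf (cf \<omega> 0) - gauss_cdf (cf \<omega> 1)\<bar>)"
    by (simp add: fun_eq_iff gauss_mass_def)
  then show ?thesis
    using has_sum_cylinder_increments[OF _ gauss_cdf_cont] gauss_cdf_mono
    by (simp add: gauss_cdf_def)
qed

lemma gauss_mass_first_digit:
  assumes "a \<ge> 1"
  shows "((\<lambda>\<omega>. gauss_mass (a # \<omega>)) has_sum gauss_mass [a]) (words n)"
proof -
  let ?F = "\<lambda>x. gauss_cdf (1 / (real a + x))"
  have sub: "1 / (real a + x) \<in> {0..1}" if "x \<in> {0..1}" for x
    using assms that by (auto simp: divide_simps)
  have anti: "1 / (real a + y) \<le> 1 / (real a + x)" if "x \<in> {0..1}" "y \<in> {0..1}" "x \<le> y" for x y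
    using assms that by (auto simp: divide_simps)
  have "antimono_on {0..1} ?F"
    using gauss_cdf_mono sub anti unfolding monotone_on_def by blast
  moreover have "continuous_on {0..1} ?F"
    by (rule continuous_on_compose2[OF gauss_cdf_cont])
       (use assms sub in \<open>auto intro!: continuous_intros\<close>)
  ultimately show ?thesis
    using has_sum_cylinder_increments[of ?F n] by (simp add: gauss_mass_def)
qed

lemma gauss_cdf_invariant_le:
  assumes "0 \<le> u" "u \<le> v" "v \<le> 1"
  shows "((\<lambda>a::nat. \<bar>gauss_cdf (1 / (real a + u)) - gauss_cdf (1 / (real a + v))\<bar>)
    has_sum \<bar>gauss_cdf u - gauss_cdf v\<bar>) {1..}"
proof -
  define H where "H k = (ln (real (Suc k) + v) - ln (real (Suc k) + u)) / ln 2" for k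
  have eq: "gauss_cdf (1 / (real (Suc k) + u)) - gauss_cdf (1 / (real (Suc k) + v)) = H k - H (Suc k)" for k
  proof -
    have *: "ln (1 + 1 / (real (Suc k) + w)) = ln (real (Suc (Suc k)) + w) - ln (real (Suc k) + w)"
      if "w \<ge> 0" for w
    proof -
      have "1 + 1 / (real (Suc k) + w) = (real (Suc (Suc k)) + w) / (real (Suc k) + w)"
        using that by (simp add: field_simps)
      then show ?thesis using that by (simp add: ln_div)
    qed
    show ?thesis using *[of u] *[of v] assms
      by (simp add: gauss_cdf_def H_def diff_divide_distrib)
  qed
  have lim: "H \<longlonglongrightarrow> 0"
  proof (rule tendsto_sandwich[of "\<lambda>_. 0" H sequentially "\<lambda>k. (1 / real (Suc k)) / ln 2"])
    have "H k \<le> (1 / real (Suc k)) / ln 2" for k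
    proof -
      have "ln (real (Suc k) + v) - ln (real (Suc k) + u) = ln ((real (Suc k) + v) / (real (Suc k) + u))"
        using assms by (simp add: ln_div)
      also have "\<dots> \<le> (real (Suc k) + v) / (real (Suc k) + u) - 1"
        using assms by (intro ln_le_minus_one divide_pos_pos) auto
      also have "\<dots> = (v - u) / (real (Suc k) + u)" using assms by (simp add: field_simps)
      also have "\<dots> \<le> 1 / real (Suc k)" using assms by (intro frac_le) auto
      finally show ?thesis unfolding H_def by (intro divide_right_mono) auto
    qed
    then show "\<forall>\<^sub>F k in sequentially. H k \<le> (1 / real (Suc k)) / ln 2" by simp
    show "\<forall>\<^sub>F k in sequentially. 0 \<le> H k" using assms by (simp add: H_def)
    have "(\<lambda>k. 1 / real (Suc k)) \<longlonglongrightarrow> 0"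
      using LIMSEQ_inverse_real_of_nat by (simp add: inverse_eq_divide)
    from tendsto_divide[OF this tendsto_const[of "ln 2"]]
    show "(\<lambda>k. (1 / real (Suc k)) / ln 2) \<longlonglongrightarrow> 0" by simp
  qed auto
  have ge: "H k - H (Suc k) \<ge> 0" for k
    unfolding eq[symmetric]
    by (simp, rule mono_onD[OF gauss_cdf_mono]) (use assms in \<open>auto simp: divide_simps\<close>)
  have "\<bar>gauss_cdf u - gauss_cdf v\<bar> = H 0"
    using mono_onD[OF gauss_cdf_mono, of u v] assms
    by (simp add: gauss_cdf_def H_def diff_divide_distrib)
  then have s: "(\<lambda>k. H k - H (Suc k)) sums \<bar>gauss_cdf u - gauss_cdf v\<bar>"
    using telescope_sums'[OF lim] by simp
  show ?thesis
    by (rule has_sum_atLeast1I) (use s ge in \<open>simp_all only: eq abs_of_nonneg abs_ge_zero\<close>)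
qed

lemma gauss_mass_invariant:
  assumes "\<omega> \<in> words n"
  shows "((\<lambda>a. gauss_mass (a # \<omega>)) has_sum gauss_mass \<omega>) {1..}"
proof -
  have b: "cf \<omega> 0 \<in> {0..1}" "cf \<omega> 1 \<in> {0..1}"
    using cf_bounds[OF assms] by auto
  show ?thesis
  proof (cases "cf \<omega> 0 \<le> cf \<omega> 1")
    case True
    then show ?thesis using gauss_cdf_invariant_le[of "cf \<omega> 0" "cf \<omega> 1"] b
      by (simp add: gauss_mass_def)
  next
    case False
    then show ?thesis using gauss_cdf_invariant_le[of "cf \<omega> 1" "cf \<omega> 0"] b
      by (simp add: gauss_mass_def abs_minus_commute)
  qed
qed

lemma gauss_mass_nonneg: "gauss_mass \<omega> \<ge> 0"
  by (simp add: gauss_mass_def)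

lemma gauss_mass_le:
  assumes "\<omega> \<in> words n"
  shows "gauss_mass \<omega> \<le> (cfprod \<omega> 0 * cfprod \<omega> 1) / ln 2"
proof -
  have *: "\<bar>ln (1 + x) - ln (1 + y)\<bar> \<le> \<bar>x - y\<bar>" if "x \<ge> 0" "y \<ge> 0" for x y :: real
  proof -
    have **: "ln (1 + a) - ln (1 + b) \<le> a - b" if "b \<ge> 0" "a \<ge> b" for a b :: real
    proof -
      have "ln (1 + a) - ln (1 + b) = ln ((1 + a) / (1 + b))" using that by (simp add: ln_div)
      also have "\<dots> \<le> (1 + a) / (1 + b) - 1" using that by (intro ln_le_minus_one) auto
      also have "\<dots> = (a - b) / (1 + b)" using that by (simp add: field_simps)
      also have "\<dots> \<le> (a - b) / 1" using that by (intro divide_left_mono) auto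
      finally show ?thesis by simp
    qed
    have mono: "ln (1 + a) \<le> ln (1 + b)" if "a \<ge> 0" "a \<le> b" for a b :: real using that by simp
    show ?thesis using **[of x y] **[of y x] mono[of x y] mono[of y x] that
      by (cases "x \<le> y") linarith+
  qed
  have b: "cf \<omega> 0 \<in> {0..1}" "cf \<omega> 1 \<in> {0..1}"
    using cf_bounds[OF assms] by auto
  have "gauss_mass \<omega> = \<bar>ln (1 + cf \<omega> 0) - ln (1 + cf \<omega> 1)\<bar> / ln 2"
    by (simp add: gauss_mass_def gauss_cdf_def flip: diff_divide_distrib)
  also have "\<dots> \<le> \<bar>cf \<omega> 0 - cf \<omega> 1\<bar> / ln 2"
    using *[of "cf \<omega> 0" "cf \<omega> 1"] b by (intro divide_right_mono) auto
  also have "\<bar>cf \<omega> 0 - cf \<omega> 1\<bar> = cfprod \<omega> 0 * cfprod \<omega> 1"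
    using cf_diff[OF assms, of 0 1] by simp
  finally show ?thesis .
qed

subsection \<open>The mean logarithm of the first digit\<close>

lemma gauss_mass_singleton:
  assumes "a \<ge> 1"
  shows "gauss_mass [a] = gauss_cdf (1 / real a) - gauss_cdf (1 / (real a + 1))"
proof -
  have "gauss_cdf (1 / (real a + 1)) \<le> gauss_cdf (1 / real a)"
    by (rule mono_onD[OF gauss_cdf_mono]) (use assms in \<open>auto simp: divide_simps\<close>)
  then show ?thesis by (simp add: gauss_mass_def)
qed

lemma summable_log_first_digit:
  "summable (\<lambda>k. gauss_mass [Suc k] * ln (real (Suc k)))"
proof (rule summable_comparison_test)
  have "summable (\<lambda>k. real (Suc k) powr (- 3/2))"
    using summable_Suc_iff[of "\<lambda>k. real k powr (- 3/2)"] by (simp add: summable_real_powr_iff)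
  then show "summable (\<lambda>k. 2 / ln 2 * real (Suc k) powr (- 3/2))"
    by (rule summable_mult)
  have "norm (gauss_mass [a] * ln (real a)) \<le> 2 / ln 2 * real a powr (- 3/2)" if a: "a \<ge> 1" for a
  proof -
    have w: "[a] \<in> words 1" using a by (auto simp: words_def)
    have "cfprod [a] 0 * cfprod [a] 1 \<le> (1 / real a) * (1 / real a)"
      using a by (intro mult_mono) (auto simp: divide_simps)
    also have "\<dots> = real a powr (- 2)"
      using a by (simp add: powr_minus powr_numeral power2_eq_square field_simps)
    finally have "cfprod [a] 0 * cfprod [a] 1 / ln 2 \<le> real a powr (- 2) / ln 2"
      by (intro divide_right_mono) auto
    with gauss_mass_le[OF w] have 1: "gauss_mass [a] \<le> real a powr (- 2) / ln 2" by linarith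
    have "ln (real a) \<le> real a powr (1/2) / (1/2)"
      using a by (intro ln_powr_bound) auto
    then have 2: "ln (real a) \<le> 2 * real a powr (1/2)" by simp
    have "gauss_mass [a] * ln (real a) \<le> (real a powr (- 2) / ln 2) * (2 * real a powr (1/2))"
      by (rule mult_mono[OF 1 2]) (use a in auto)
    also have "\<dots> = 2 / ln 2 * (real a powr (- 2) * real a powr (1/2))" by simp
    also have "real a powr (- 2) * real a powr (1/2) = real a powr (- 3/2)"
      by (simp flip: powr_add)
    finally show ?thesis using a gauss_mass_nonneg[of "[a]"] by simp
  qed
  then show "\<exists>N. \<forall>k\<ge>N. norm (gauss_mass [Suc k] * ln (real (Suc k))) \<le> 2 / ln 2 * real (Suc k) powr (- 3/2)"
    by (metis le_add1 plus_1_eq_Suc)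
qed

lemma nn_integral_gauss_density_cylinder:
  "(\<integral>\<^sup>+x. ennreal (1 / ((1 + x) * ln 2)) * indicator {1 / real (Suc (Suc k)) <.. 1 / real (Suc k)} x \<partial>lborel)
    = ennreal (gauss_mass [Suc k])"
proof -
  let ?a = "1 / real (Suc (Suc k))" and ?b = "1 / real (Suc k)"
  let ?g = "\<lambda>x. 1 / ((1 + x) * ln 2) * indicator {0..} x :: real"
  have "(\<integral>\<^sup>+x. ennreal (1 / ((1 + x) * ln 2)) * indicator {?a <.. ?b} x \<partial>lborel) =
    (\<integral>\<^sup>+x. ennreal (?g x) * indicator {?a .. ?b} x \<partial>lborel)"
  proof (rule nn_integral_cong_AE)
    have pos: "?a > 0" by simp
    show "AE x in lborel. ennreal (1 / ((1 + x) * ln 2)) * indicator {?a <.. ?b} x =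
      ennreal (?g x) * indicator {?a .. ?b} x"
      using AE_lborel_singleton[of ?a]
    proof eventually_elim
      case (elim x)
      then show ?case using pos less_trans[OF pos, of x]
        by (auto simp: indicator_def)
    qed
  qed
  also have "\<dots> = ennreal (gauss_cdf ?b - gauss_cdf ?a)"
  proof (rule nn_integral_FTC_Icc)
    have pos: "?a > 0" by simp
    show "?g \<in> borel_measurable borel" by measurable
    show "?a \<le> ?b" by (simp add: field_simps)
    fix x assume "x \<in> {?a..?b}"
    then have x: "x > 0" using pos by (meson atLeastAtMost_iff less_le_trans)
    then show "0 \<le> ?g x" by simp
    have "((\<lambda>x. ln (1 + x) / ln 2) has_real_derivative (1 / (1 + x)) / ln 2) (at x)"
      using x by (intro DERIV_cdivide) (auto intro!: derivative_eq_intros)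
    then show "(gauss_cdf has_real_derivative ?g x) (at x)"
      using x by (simp add: gauss_cdf_def[abs_def])
  qed
  also have "gauss_cdf ?b - gauss_cdf ?a = gauss_mass [Suc k]"
    by (simp add: gauss_mass_singleton add_ac)
  finally show ?thesis .
qed

lemma log_first_digit_eq_suminf:
  assumes "x \<in> {0..<1}"
  shows "ennreal (ln (real_of_int (a1 x))) =
    (\<Sum>k. ennreal (ln (real (Suc k))) * indicator {1 / real (Suc (Suc k)) <.. 1 / real (Suc k)} x)"
proof (cases "x = 0")
  case True
  then show ?thesis by (simp add: a1_def indicator_def)
next
  case False
  then have x: "0 < x" "x < 1" using assms by auto
  define j where "j = nat (a1 x) - 1"
  have "a1 x \<ge> 1" using x by (simp add: a1_def le_floor_iff field_simps)
  then have j: "a1 x = int (Suc j)" by (simp add: j_def)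
  have iff: "x \<in> {1 / real (Suc (Suc k)) <.. 1 / real (Suc k)} \<longleftrightarrow> k = j" for k
  proof -
    have "x \<in> {1 / real (Suc (Suc k)) <.. 1 / real (Suc k)} \<longleftrightarrow>
      real (Suc k) \<le> 1 / x \<and> 1 / x < real (Suc k) + 1"
      using x by (auto simp: field_simps)
    also have "\<dots> \<longleftrightarrow> a1 x = int (Suc k)"
      unfolding a1_def floor_eq_iff by simp
    finally show ?thesis using j by auto
  qed
  have "(\<Sum>k. ennreal (ln (real (Suc k))) * indicator {1 / real (Suc (Suc k)) <.. 1 / real (Suc k)} x) =
    (\<Sum>k\<in>{j}. ennreal (ln (real (Suc k))) * indicator {1 / real (Suc (Suc k)) <.. 1 / real (Suc k)} x)"
    by (rule suminf_finite) (use iff in \<open>auto simp: indicator_def\<close>)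
  also have "\<dots> = ennreal (ln (real (Suc j)))"
    using iff[of j] by (simp add: indicator_def)
  finally show ?thesis using j by simp
qed

lemma \<xi>0_sums: "(\<lambda>k. gauss_mass [Suc k] * ln (real (Suc k))) sums \<xi>0"
proof -
  let ?g = "\<lambda>x::real. ennreal (1 / ((1 + x) * ln 2))"
  let ?B = "\<lambda>k. {1 / real (Suc (Suc k)) <.. 1 / real (Suc k)}"
  let ?f = "\<lambda>x. ln (real_of_int (a1 x))"
  let ?m = "\<lambda>k. gauss_mass [Suc k] * ln (real (Suc k))"
  have meas: "?f \<in> borel_measurable borel" unfolding a1_def by measurable
  have [measurable]: "?f \<in> borel_measurable (restrict_space lborel {0..<1})"
    using meas by (intro measurable_restrict_space1) simp
  have [measurable]: "?g \<in> borel_measurable (restrict_space lborel {0..<1})"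
    by (intro measurable_restrict_space1) simp
  have nonneg: "?f x \<ge> 0" if "x \<in> {0..<1}" for x
  proof (cases "x = 0")
    case False
    then have "a1 x \<ge> 1" using that by (simp add: a1_def le_floor_iff field_simps)
    then show ?thesis by simp
  qed (simp add: a1_def)
  have "\<xi>0 = enn2real (\<integral>\<^sup>+x. ennreal (?f x) \<partial>gauss_measure)"
    unfolding \<xi>0_def
  proof (rule integral_eq_nn_integral)
    show "?f \<in> borel_measurable gauss_measure" unfolding gauss_measure_def by simp
    show "AE x in gauss_measure. 0 \<le> ?f x"
      using nonneg by (intro AE_I2) (auto simp: gauss_measure_def space_restrict_space)
  qed
  also have "(\<integral>\<^sup>+x. ennreal (?f x) \<partial>gauss_measure) =
      (\<integral>\<^sup>+x. ?g x * ennreal (?f x) \<partial>restrict_space lborel {0..<1})"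
    unfolding gauss_measure_def by (rule nn_integral_density) measurable
  also have "\<dots> = (\<integral>\<^sup>+x. ?g x * ennreal (?f x) * indicator {0..<1} x \<partial>lborel)"
    by (rule nn_integral_restrict_space) simp
  also have "\<dots> = (\<integral>\<^sup>+x. (\<Sum>k. ennreal (ln (real (Suc k))) * (?g x * indicator (?B k) x)) \<partial>lborel)"
  proof (rule nn_integral_cong)
    fix x :: real
    show "?g x * ennreal (?f x) * indicator {0..<1} x =
      (\<Sum>k. ennreal (ln (real (Suc k))) * (?g x * indicator (?B k) x))"
    proof (cases "x \<in> {0..<1}")
      case True
      then show ?thesis
        using log_first_digit_eq_suminf[OF True]
        by (simp add: ennreal_suminf_cmult[symmetric] mult_ac)
    next
      case False
      have "ln (real (Suc k)) = 0 \<or> x \<notin> ?B k" for k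
      proof (cases k)
        case (Suc l)
        have "1 / real (Suc k) < 1" "1 / real (Suc (Suc k)) > 0" using Suc by auto
        then have "x \<in> ?B k \<Longrightarrow> x \<in> {0..<1}"
          by (meson atLeastLessThan_iff greaterThanAtMost_iff le_less_trans less_imp_le less_trans)
        then show ?thesis using False by blast
      qed simp
      then have "ennreal (ln (real (Suc k))) * (?g x * indicator (?B k) x) = 0" for k
        by (auto simp: indicator_def)
      then have "(\<Sum>k. ennreal (ln (real (Suc k))) * (?g x * indicator (?B k) x)) = 0"
        by (simp only: suminf_zero)
      then show ?thesis using False by (simp only: indicator_simps(2)[OF False] mult_zero_right)
    qed
  qed
  also have "\<dots> = (\<Sum>k. \<integral>\<^sup>+x. ennreal (ln (real (Suc k))) * (?g x * indicator (?B k) x) \<partial>lborel)"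
    by (rule nn_integral_suminf) measurable
  also have "\<dots> = (\<Sum>k. ennreal (?m k))"
  proof (rule suminf_cong)
    fix k
    have "(\<integral>\<^sup>+x. ennreal (ln (real (Suc k))) * (?g x * indicator (?B k) x) \<partial>lborel) =
      ennreal (ln (real (Suc k))) * ennreal (gauss_mass [Suc k])"
      by (subst nn_integral_cmult) (use nn_integral_gauss_density_cylinder[of k] in simp_all)
    then show "(\<integral>\<^sup>+x. ennreal (ln (real (Suc k))) * (?g x * indicator (?B k) x) \<partial>lborel) = ennreal (?m k)"
      by (simp add: gauss_mass_nonneg mult.commute flip: ennreal_mult)
  qed
  also have "\<dots> = ennreal (suminf ?m)"
    by (rule suminf_ennreal2[OF _ summable_log_first_digit]) (simp add: gauss_mass_nonneg)
  finally have "\<xi>0 = enn2real (ennreal (suminf ?m))" .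
  moreover have "0 \<le> suminf ?m"
    by (rule suminf_nonneg[OF summable_log_first_digit]) (simp add: gauss_mass_nonneg)
  ultimately have "\<xi>0 = suminf ?m" by (simp only: enn2real_ennreal)
  then show ?thesis using summable_sums[OF summable_log_first_digit] by (simp only:)
qed

lemma \<xi>0_pos: "\<xi>0 > 0"
proof -
  have "gauss_mass [Suc 1] > 0"
    by (simp add: gauss_mass_singleton gauss_cdf_def divide_strict_right_mono)
  then have "0 < gauss_mass [Suc 1] * ln (real (Suc 1))" by simp
  also have "\<dots> \<le> \<xi>0"
    using sum_le_suminf[OF summable_log_first_digit, of "{1}"] sums_unique[OF \<xi>0_sums]
    by (simp add: gauss_mass_nonneg)
  finally show ?thesis .
qed

lemma gauss_mass_log_prod_has_sum:
  "((\<lambda>\<omega>. gauss_mass \<omega> * ln (real (prod_list \<omega>))) has_sum real n * \<xi>0) (words n)"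
proof (induction n)
  case 0
  show ?case using has_sum_words_0[of "\<lambda>\<omega>. gauss_mass \<omega> * ln (real (prod_list \<omega>))"] by simp
next
  case (Suc n)
  have pos: "ln (real (prod_list \<omega>)) \<ge> 0" if "\<omega> \<in> words m" for \<omega> m
    using cfprod_bounds(4)[OF that, of 0] by simp
  have "((\<lambda>\<omega>. gauss_mass \<omega> * ln (real (hd \<omega>))) has_sum \<xi>0) (words (Suc n))"
  proof (rule has_sum_words_Suc)
    show "((\<lambda>\<omega>. gauss_mass (a # \<omega>) * ln (real (hd (a # \<omega>)))) has_sum gauss_mass [a] * ln (real a)) (words n)"
      if "a \<ge> 1" for a
      using has_sum_cmult_left[OF gauss_mass_first_digit[OF that, of n], of "ln (real a)"] by simp
    show "((\<lambda>a. gauss_mass [a] * ln (real a)) has_sum \<xi>0) {1..}"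
      using \<xi>0_sums by (rule has_sum_atLeast1I) (simp add: gauss_mass_nonneg)
    show "0 \<le> gauss_mass \<omega> * ln (real (hd \<omega>))" if "\<omega> \<in> words (Suc n)" for \<omega>
      using that by (elim words_SucE) (auto simp: gauss_mass_nonneg)
  qed
  moreover have "((\<lambda>\<omega>. gauss_mass \<omega> * ln (real (prod_list (tl \<omega>)))) has_sum real n * \<xi>0) (words (Suc n))"
  proof (rule has_sum_words_Suc_swap[OF _ Suc])
    show "((\<lambda>a. gauss_mass (a # \<omega>) * ln (real (prod_list (tl (a # \<omega>))))) has_sum
        gauss_mass \<omega> * ln (real (prod_list \<omega>))) {1..}" if "\<omega> \<in> words n" for \<omega>
      using has_sum_cmult_left[OF gauss_mass_invariant[OF that]] by simp
    show "0 \<le> gauss_mass \<omega> * ln (real (prod_list (tl \<omega>)))" if "\<omega> \<in> words (Suc n)" for \<omega>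
      using that by (elim words_SucE) (auto intro!: mult_nonneg_nonneg gauss_mass_nonneg pos)
  qed
  ultimately have *: "((\<lambda>\<omega>. gauss_mass \<omega> * ln (real (hd \<omega>)) + gauss_mass \<omega> * ln (real (prod_list (tl \<omega>))))
      has_sum (\<xi>0 + real n * \<xi>0)) (words (Suc n))"
    by (rule has_sum_add)
  have eq: "gauss_mass \<omega> * ln (real (hd \<omega>)) + gauss_mass \<omega> * ln (real (prod_list (tl \<omega>))) =
    gauss_mass \<omega> * ln (real (prod_list \<omega>))" if w: "\<omega> \<in> words (Suc n)" for \<omega>
  proof -
    obtain a \<eta> where \<omega>: "\<omega> = a # \<eta>" "a \<ge> 1" "\<eta> \<in> words n" using w by (elim words_SucE) blast
    have "prod_list \<eta> \<ge> 1" using cfprod_bounds(4)[OF \<omega>(3), of 0] by simp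
    then have "ln (real (prod_list \<omega>)) = ln (real a) + ln (real (prod_list \<eta>))"
      using \<omega> by (simp add: ln_mult_pos)
    then show ?thesis using \<omega> by (simp add: distrib_left)
  qed
  have "((\<lambda>\<omega>. gauss_mass \<omega> * ln (real (prod_list \<omega>))) has_sum (\<xi>0 + real n * \<xi>0)) (words (Suc n))"
    using * by (subst has_sum_cong[OF eq[symmetric]])
  then show ?case by (simp add: distrib_right)
qed

subsection \<open>Lower bound and convexity of the pressure\<close>

lemma weight_1_bounds:
  assumes "\<omega> \<in> words n"
  shows "real (prod_list \<omega>) powr q * \<bar>cf \<omega> 0 - cf \<omega> 1\<bar> \<le> weight 1 q \<omega>"
    and "weight 1 q \<omega> \<le> 4 * (real (prod_list \<omega>) powr q * \<bar>cf \<omega> 0 - cf \<omega> 1\<bar>)"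
proof -
  let ?p = "cfprod \<omega>"
  have pos: "?p x > 0" if "x \<in> {0..1}" for x using cfprod_bounds(1)[OF assms that] .
  have sq: "?p x powr (2 * 1) = ?p x * ?p x" if "x \<in> {0..1}" for x
    using pos[OF that] by (simp add: powr_numeral power2_eq_square)
  have leb: "\<bar>cf \<omega> 0 - cf \<omega> 1\<bar> = ?p 0 * ?p 1"
    using cf_diff[OF assms, of 0 1] by simp
  define x :: real where "x = (if ?p 1 \<le> ?p 0 then 0 else 1)"
  have x: "x \<in> {0..1}" by (simp add: x_def)
  have "?p 0 * ?p 1 \<le> ?p x * ?p x"
    using pos[of 0] pos[of 1] by (intro mult_mono) (auto simp: x_def)
  then have "real (prod_list \<omega>) powr q * \<bar>cf \<omega> 0 - cf \<omega> 1\<bar> \<le> real (prod_list \<omega>) powr q * ?p x powr (2 * 1)"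
    unfolding leb sq[OF x] by (intro mult_left_mono) auto
  also have "\<dots> \<le> weight 1 q \<omega>" by (rule weight_ge[OF assms x]) simp
  finally show "real (prod_list \<omega>) powr q * \<bar>cf \<omega> 0 - cf \<omega> 1\<bar> \<le> weight 1 q \<omega>" .
  show "weight 1 q \<omega> \<le> 4 * (real (prod_list \<omega>) powr q * \<bar>cf \<omega> 0 - cf \<omega> 1\<bar>)"
  proof (rule weight_le[OF assms])
    fix y :: real assume y: "y \<in> {0..1}"
    have "?p y * ?p y \<le> (2 * ?p 0) * (2 * ?p 1)"
      using pos[OF y] pos[of 0] y
      by (intro mult_mono cfprod_distortion[OF assms]) auto
    then have "real (prod_list \<omega>) powr q * (?p y * ?p y) \<le> real (prod_list \<omega>) powr q * ((2 * ?p 0) * (2 * ?p 1))"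
      by (rule mult_left_mono) simp
    then show "real (prod_list \<omega>) powr q * ?p y powr (2 * 1) \<le> 4 * (real (prod_list \<omega>) powr q * \<bar>cf \<omega> 0 - cf \<omega> 1\<bar>)"
      unfolding leb sq[OF y] by (simp add: mult_ac)
  qed simp
qed

text \<open>Jensen's inequality for the Gauss masses of the cylinders, whose mean of
  \<open>ln (prod_list \<omega>)\<close> is \<open>n * \<xi>0\<close> by invariance of the Gauss measure.\<close>

lemma partition_sum_1_ge:
  assumes "q < 1"
  shows "ln 2 * exp (q * \<xi>0 * real n) \<le> partition_sum 1 q n"
proof -
  define c where "c = q * \<xi>0 * real n"
  let ?y = "\<lambda>\<omega>. ln (real (prod_list \<omega>))"
  have "((\<lambda>\<omega>. exp c * (1 - c) * gauss_mass \<omega> + exp c * q * (gauss_mass \<omega> * ?y \<omega>)) has_sum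
      (exp c * (1 - c) * 1 + exp c * q * (real n * \<xi>0))) (words n)"
    by (intro has_sum_add has_sum_cmult_right gauss_mass_has_sum gauss_mass_log_prod_has_sum)
  moreover have "exp c * (1 - c) * 1 + exp c * q * (real n * \<xi>0) = exp c"
    by (simp add: c_def algebra_simps)
  ultimately have *: "((\<lambda>\<omega>. exp c * (1 - c) * gauss_mass \<omega> + exp c * q * (gauss_mass \<omega> * ?y \<omega>))
      has_sum exp c) (words n)" by simp
  have sums: "((\<lambda>\<omega>. weight 1 q \<omega> / ln 2) has_sum partition_sum 1 q n / ln 2) (words n)"
    using has_sum_cmult_left[OF has_sum_infsum[OF summable_weight[of 1 q n]], of "1 / ln 2"] assms
    by (simp add: partition_sum_eq)
  have "exp c \<le> partition_sum 1 q n / ln 2"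
  proof (rule has_sum_mono[OF * sums])
    fix \<omega> assume \<omega>: "\<omega> \<in> words n"
    have N: "real (prod_list \<omega>) > 0" using cfprod_bounds(4)[OF \<omega>, of 0] by simp
    have "exp c * (1 - c) * gauss_mass \<omega> + exp c * q * (gauss_mass \<omega> * ?y \<omega>) =
      (exp c * (1 + (q * ?y \<omega> - c))) * gauss_mass \<omega>" by (simp add: algebra_simps)
    also have "\<dots> \<le> (exp c * exp (q * ?y \<omega> - c)) * gauss_mass \<omega>"
      by (intro mult_right_mono mult_left_mono exp_ge_add_one_self gauss_mass_nonneg) simp
    also have "exp c * exp (q * ?y \<omega> - c) = real (prod_list \<omega>) powr q"
      using N by (simp add: powr_def flip: exp_add)
    also have "real (prod_list \<omega>) powr q * gauss_mass \<omega> \<le>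
        real (prod_list \<omega>) powr q * (\<bar>cf \<omega> 0 - cf \<omega> 1\<bar> / ln 2)"
      using gauss_mass_le[OF \<omega>] cf_diff[OF \<omega>, of 0 1] by (intro mult_left_mono) auto
    also have "\<dots> \<le> weight 1 q \<omega> / ln 2"
      using weight_1_bounds(1)[OF \<omega>, of q] by (simp add: divide_right_mono)
    finally show "exp c * (1 - c) * gauss_mass \<omega> + exp c * q * (gauss_mass \<omega> * ?y \<omega>) \<le> weight 1 q \<omega> / ln 2" .
  qed
  then show ?thesis by (simp add: c_def field_simps)
qed

lemma P_1_ge:
  assumes "q < 1"
  shows "q * \<xi>0 \<le> P 1 q"
proof (rule LIMSEQ_le)
  show "(\<lambda>n. ln (partition_sum 1 q n) / real n) \<longlonglongrightarrow> P 1 q"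
    by (rule P_tendsto) (use assms in auto)
  show "(\<lambda>n. q * \<xi>0 + ln (ln 2) / real n) \<longlonglongrightarrow> q * \<xi>0"
    using tendsto_add[OF tendsto_const lim_const_over_n[of "ln (ln 2)"]] by simp
  show "\<exists>N. \<forall>n\<ge>N. q * \<xi>0 + ln (ln 2) / real n \<le> ln (partition_sum 1 q n) / real n"
  proof (intro exI[of _ 1] allI impI)
    fix n :: nat assume n: "n \<ge> 1"
    have "ln (ln 2 * exp (q * \<xi>0 * real n)) \<le> ln (partition_sum 1 q n)"
      by (rule ln_mono[OF partition_sum_1_ge[OF assms]]) simp
    then have "(ln (ln 2) + q * \<xi>0 * real n) / real n \<le> ln (partition_sum 1 q n) / real n"
      by (intro divide_right_mono) (auto simp: ln_mult_pos)
    then show "q * \<xi>0 + ln (ln 2) / real n \<le> ln (partition_sum 1 q n) / real n"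
      using n by (simp add: add_divide_distrib)
  qed
qed

lemma P_ge:
  assumes "(t, q) \<in> D0"
  shows "q * \<xi>0 \<le> P t q"
  using assms P_1_ge[of q] P_mono[of t q] by (auto simp: D0_def)

lemma scale_less_1:
  fixes q s :: real
  assumes "q < 1" "0 \<le> s" "s \<le> 1"
  shows "s * q < 1"
proof (cases "q \<le> 0")
  case True
  then show ?thesis using mult_nonneg_nonpos[OF assms(2), of q] by linarith
next
  case False
  then show ?thesis using mult_right_mono[OF assms(3), of q] assms(1) by linarith
qed

lemma partition_sum_1_scale:
  assumes "q < 1" "0 \<le> s" "s \<le> 1"
  shows "partition_sum 1 (s * q) n \<le> 4 * partition_sum 1 q n powr s"
proof -
  let ?L = "\<lambda>\<omega>. \<bar>cf \<omega> 0 - cf \<omega> 1\<bar>" and ?N = "\<lambda>\<omega>. real (prod_list \<omega>)"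
  define M where "M = infsum (\<lambda>\<omega>. ?N \<omega> powr q * ?L \<omega>) (words n)"
  have sq: "s * q < 1" by (rule scale_less_1) fact+
  have W: "weight 1 q summable_on words n" by (rule summable_weight) (use assms in auto)
  have "(\<lambda>\<omega>. ?N \<omega> powr q * ?L \<omega>) summable_on words n"
    by (rule summable_on_comparison_test[OF W]) (auto intro: weight_1_bounds)
  then have M: "((\<lambda>\<omega>. ?N \<omega> powr q * ?L \<omega>) has_sum M) (words n)"
    unfolding M_def by (rule has_sum_infsum)
  have M_le: "M \<le> partition_sum 1 q n"
    unfolding partition_sum_eq by (rule has_sum_mono[OF M has_sum_infsum[OF W]]) (rule weight_1_bounds)
  have "partition_sum 1 q n \<le> 4 * M"
    unfolding partition_sum_eq
    by (rule has_sum_mono[OF has_sum_infsum[OF W] has_sum_cmult_right[OF M]]) (rule weight_1_bounds)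
  then have M_pos: "M > 0" using partition_sum_pos[of 1 q n] assms by simp
  have L: "(?L has_sum 1) (words n)"
    using has_sum_cylinder_increments[of "\<lambda>x. x" n] by (simp add: monotone_on_def)
  define k where "k = 4 * M powr (s - 1)"
  have "((\<lambda>\<omega>. k * (1 - s) * M * ?L \<omega> + k * s * (?N \<omega> powr q * ?L \<omega>)) has_sum
      (k * (1 - s) * M * 1 + k * s * M)) (words n)"
    by (intro has_sum_add has_sum_cmult_right M L)
  moreover have "k * (1 - s) * M * 1 + k * s * M = 4 * M powr s"
  proof -
    have "k * M = 4 * M powr s" using M_pos by (simp add: k_def powr_diff)
    moreover have "k * (1 - s) * M * 1 + k * s * M = k * M" by (simp add: algebra_simps)
    ultimately show ?thesis by simp
  qed
  ultimately have sum: "((\<lambda>\<omega>. k * (1 - s) * M * ?L \<omega> + k * s * (?N \<omega> powr q * ?L \<omega>)) has_sum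
      4 * M powr s) (words n)" by simp
  have "partition_sum 1 (s * q) n \<le> 4 * M powr s"
    unfolding partition_sum_eq
  proof (rule has_sum_mono[OF has_sum_infsum[OF summable_weight] sum])
    fix \<omega> assume \<omega>: "\<omega> \<in> words n"
    have N: "?N \<omega> > 0" using cfprod_bounds(4)[OF \<omega>, of 0] by simp
    have "M powr (1 - s) * ?N \<omega> powr (s * q) = M powr (1 - s) * (?N \<omega> powr q) powr s"
      by (simp add: powr_powr mult.commute)
    also have "\<dots> \<le> (1 - s) * M + s * ?N \<omega> powr q"
      by (rule Youngs_inequality_0) (use assms M_pos N in auto)
    finally have "k * (M powr (1 - s) * ?N \<omega> powr (s * q)) \<le> k * ((1 - s) * M + s * ?N \<omega> powr q)"
      by (rule mult_left_mono) (simp add: k_def)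
    moreover have "k * (M powr (1 - s) * ?N \<omega> powr (s * q)) = 4 * ?N \<omega> powr (s * q)"
      using M_pos by (simp add: k_def flip: powr_add)
    ultimately have "4 * ?N \<omega> powr (s * q) \<le> k * ((1 - s) * M + s * ?N \<omega> powr q)" by simp
    then have "4 * ?N \<omega> powr (s * q) * ?L \<omega> \<le> k * ((1 - s) * M + s * ?N \<omega> powr q) * ?L \<omega>"
      by (rule mult_right_mono) simp
    then show "weight 1 (s * q) \<omega> \<le> k * (1 - s) * M * ?L \<omega> + k * s * (?N \<omega> powr q * ?L \<omega>)"
      using weight_1_bounds(2)[OF \<omega>, of "s * q"] by (simp add: algebra_simps)
  qed (use sq in auto)
  also have "M powr s \<le> partition_sum 1 q n powr s"
    using M_le M_pos assms by (intro powr_mono2) auto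
  finally show ?thesis by simp
qed

lemma P_1_scale:
  assumes "q < 1" "0 \<le> s" "s \<le> 1"
  shows "P 1 (s * q) \<le> s * P 1 q"
proof (rule LIMSEQ_le)
  have sq: "s * q < 1" by (rule scale_less_1) fact+
  then show "(\<lambda>n. ln (partition_sum 1 (s * q) n) / real n) \<longlonglongrightarrow> P 1 (s * q)"
    by (intro P_tendsto) auto
  have "(\<lambda>n. ln (partition_sum 1 q n) / real n) \<longlonglongrightarrow> P 1 q"
    by (rule P_tendsto) (use assms in auto)
  from tendsto_add[OF lim_const_over_n[of "ln 4"] tendsto_mult[OF tendsto_const[of s] this]]
  show "(\<lambda>n. ln 4 / real n + s * (ln (partition_sum 1 q n) / real n)) \<longlonglongrightarrow> s * P 1 q" by simp
  show "\<exists>N. \<forall>n\<ge>N. ln (partition_sum 1 (s * q) n) / real n \<le>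
    ln 4 / real n + s * (ln (partition_sum 1 q n) / real n)"
  proof (intro exI allI impI)
    fix n :: nat
    have pos: "partition_sum 1 q n > 0" "partition_sum 1 (s * q) n > 0"
      using assms sq by (auto intro: partition_sum_pos)
    have "ln (partition_sum 1 (s * q) n) \<le> ln (4 * partition_sum 1 q n powr s)"
      by (rule ln_mono[OF partition_sum_1_scale[OF assms] pos(2)])
    also have "\<dots> = ln 4 + s * ln (partition_sum 1 q n)"
      using pos by (simp add: ln_mult_pos ln_powr)
    finally have "ln (partition_sum 1 (s * q) n) / real n \<le> (ln 4 + s * ln (partition_sum 1 q n)) / real n"
      by (rule divide_right_mono) simp
    then show "ln (partition_sum 1 (s * q) n) / real n \<le>
      ln 4 / real n + s * (ln (partition_sum 1 q n) / real n)"
      by (simp add: add_divide_distrib)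
  qed
qed

lemma solution_zero_imp:
  assumes "(t, 0) \<in> D0" "solves_system \<xi> t 0"
  shows "\<xi> = \<xi>0"
proof -
  let ?h = "\<lambda>q. P t q - q * \<xi>0"
  have "(?h has_real_derivative (\<xi> - 1 * \<xi>0)) (at 0)"
    using assms(2) unfolding solves_system_def
    by (intro DERIV_diff DERIV_cmult_right DERIV_ident) auto
  moreover have "2 * t - 1 > 0" using assms(1) by (auto simp: D0_def)
  moreover have "\<forall>q. \<bar>0 - q\<bar> < 2 * t - 1 \<longrightarrow> ?h 0 \<le> ?h q"
    using assms P_ge[of t] by (auto simp: D0_def solves_system_def)
  ultimately have "\<xi> - 1 * \<xi>0 = 0" by (rule DERIV_local_min)
  then show ?thesis by simp
qed

text \<open>If \<open>q \<noteq> 0\<close>, then \<open>P 1\<close> is squeezed onto the line of slope \<open>\<xi>0\<close> between \<open>0\<close> and \<open>q\<close>,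
  so the midpoint yields a second solution.\<close>

lemma unique_solution_at_\<xi>0:
  assumes "unique_solution_in_D0 \<xi>0 t q"
  shows "q = 0"
proof (rule ccontr)
  assume q0: "q \<noteq> 0"
  have tq: "(t, q) \<in> D0" "P t q = q * \<xi>0"
    and uniq: "\<And>t' q'. (t', q') \<in> D0 \<Longrightarrow> solves_system \<xi>0 t' q' \<Longrightarrow> q' = q"
    using assms by (auto simp: unique_solution_in_D0_def solves_system_def)
  have q1: "q < 1" using tq by (auto simp: D0_def)
  have Pq: "P 1 q = q * \<xi>0"
    using tq P_mono[of t q] P_1_ge[OF q1] by (auto simp: D0_def)
  have line: "P 1 (s * q) = s * q * \<xi>0" if "0 \<le> s" "s \<le> 1" for s
  proof -
    have "s * q < 1" by (rule scale_less_1[OF q1 that])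
    then show ?thesis
      using P_1_scale[OF q1 that] P_1_ge[of "s * q"] Pq by simp
  qed
  have "((\<lambda>q'. P 1 q') has_real_derivative \<xi>0) (at (q / 2))"
  proof (rule DERIV_cong_ev[THEN iffD1, OF refl _ refl])
    show "((\<lambda>q'. q' * \<xi>0) has_real_derivative \<xi>0) (at (q / 2))"
      by (auto intro!: derivative_eq_intros)
    have "\<forall>\<^sub>F q' in nhds (q / 2). dist q' (q / 2) < \<bar>q\<bar> / 2"
      using q0 by (intro eventually_nhds_metric[THEN iffD2] exI[of _ "\<bar>q\<bar> / 2"]) auto
    then show "\<forall>\<^sub>F q' in nhds (q / 2). q' * \<xi>0 = P 1 q'"
    proof eventually_elim
      case (elim q')
      then have "0 \<le> q' / q" "q' / q \<le> 1"
        by (auto simp: dist_real_def divide_simps abs_if split: if_splits)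
      from line[OF this] q0 show ?case by simp
    qed
  qed
  moreover have "P 1 (q / 2) = q / 2 * \<xi>0" using line[of "1/2"] by simp
  ultimately have "solves_system \<xi>0 1 (q / 2)" by (simp add: solves_system_def)
  moreover have "(1, q / 2) \<in> D0" using q1 by (auto simp: D0_def)
  ultimately show False using uniq[of 1 "q / 2"] q0 by simp
qed

theorem proposition4p14:
  fixes t q :: "real \<Rightarrow> real"
  assumes "\<And>\<xi>. \<xi> > 0 \<Longrightarrow> unique_solution_in_D0 \<xi> (t \<xi>) (q \<xi>)"
  shows "(\<forall>\<xi>. 0 < \<xi> \<and> \<xi> < \<xi>0 \<longrightarrow> q \<xi> < 0) \<and> q \<xi>0 = 0 \<and> (\<forall>\<xi>. \<xi> > \<xi>0 \<longrightarrow> q \<xi> > 0)"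
proof -
  have *: "q \<xi> * (\<xi> - \<xi>0) > 0" if \<xi>: "\<xi> > 0" "\<xi> \<noteq> \<xi>0" for \<xi>
  proof -
    have D: "(t \<xi>, q \<xi>) \<in> D0" and S: "solves_system \<xi> (t \<xi>) (q \<xi>)"
      using assms[OF \<xi>(1)] by (auto simp: unique_solution_in_D0_def)
    have "q \<xi> * \<xi>0 \<le> q \<xi> * \<xi>" using P_ge[OF D] S by (simp add: solves_system_def)
    moreover have "q \<xi> \<noteq> 0" using solution_zero_imp[of "t \<xi>" \<xi>] D S \<xi> by auto
    ultimately show ?thesis using \<xi> by (simp add: right_diff_distrib order_less_le)
  qed
  have "q \<xi> < 0" if "0 < \<xi>" "\<xi> < \<xi>0" for \<xi>
    using *[of \<xi>] that by (simp add: zero_less_mult_iff)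
  moreover have "q \<xi> > 0" if "\<xi> > \<xi>0" for \<xi>
    using *[of \<xi>] that \<xi>0_pos by (simp add: zero_less_mult_iff)
  ultimately show ?thesis
    using unique_solution_at_\<xi>0[OF assms[OF \<xi>0_pos]] by blast
qed

end
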